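(* Let $G$ be a bipartite graph on $n$ vertices whose two parts have equal size. Then $\theta(G)\leq n^{8/9+o(1)}$; that is, there is a function $f$ with $f(n)\to 0$ as $n\to\infty$ such that every such graph satisfies $\theta(G)\leq n^{8/9+f(n)}$.
   Context: An interval colouring of a graph $G=(V,E)$ is an edge-colouring $c\colon E\to\mathbb{Z}$ such that for every vertex $x$, the multiset of colours of edges incident to $x$ forms an interval of $\mathbb{Z}$. The interval thickness $\theta(G)$ is the smallest integer $k$ such that $E(G)$ can be partitioned into $k$ sets each inducing an interval colourable graph. *)

theory Defs
  imports Complex_Main "HOL-Library.Multiset" "HOL-Library.Disjoint_Sets"
begin

definition simple_graph :: "'a set \<Rightarrow> 'a set set \<Rightarrow> bool" where
  "simple_graph V E \<longleftrightarrow> finite V \<and> (\<forall>e\<in>E. e \<subseteq> V \<and> card e = 2)"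

definition bipartition :: "'a set \<Rightarrow> 'a set set \<Rightarrow> 'a set \<Rightarrow> 'a set \<Rightarrow> bool" where
  "bipartition V E A B \<longleftrightarrow>
     A \<union> B = V \<and> A \<inter> B = {} \<and> (\<forall>e\<in>E. \<exists>a\<in>A. \<exists>b\<in>B. e = {a, b})"

text \<open>
  The colours at a vertex are compared with an integer interval as multisets, so each colour
  of the interval occurs exactly once and interval colourings are proper. The interval may be
  empty (\<open>b < a\<close>), which is the case at an isolated vertex.
\<close>

definition interval_colouring :: "'a set \<Rightarrow> 'a set set \<Rightarrow> ('a set \<Rightarrow> int) \<Rightarrow> bool" where
  "interval_colouring V E c \<longleftrightarrow>
     (\<forall>x\<in>V. \<exists>a b. image_mset c (mset_set {e \<in> E. x \<in> e}) = mset_set {a..b})"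

definition interval_colourable :: "'a set \<Rightarrow> 'a set set \<Rightarrow> bool" where
  "interval_colourable V E \<longleftrightarrow> (\<exists>c. interval_colouring V E c)"

text \<open>
  The graph induced by an edge set \<open>F\<close> has vertex set \<open>\<Union>F\<close>. Parts of a \<^const>\<open>partition_on\<close>
  are nonempty, which does not affect the minimum; an edgeless graph has thickness 0.
\<close>

definition interval_thickness :: "'a set set \<Rightarrow> nat" where
  "interval_thickness E = (LEAST k. \<exists>P. partition_on E P \<and> finite P \<and> card P = k \<and>
     (\<forall>F\<in>P. interval_colourable (\<Union>F) F))"

text \<open>The minimum is attained, since single edges are interval colourable.\<close>

lemma interval_thickness_attained:
  assumes "finite E"
  shows "\<exists>P. partition_on E P \<and> finite P \<and> card P = interval_thickness E \<and>
    (\<forall>F\<in>P. interval_colourable (\<Union>F) F)"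
  unfolding interval_thickness_def
proof (rule LeastI_ex)
  have "interval_colourable (\<Union>{e}) {e}" for e :: "'a set"
    unfolding interval_colourable_def interval_colouring_def
  proof (intro exI ballI)
    fix x assume "x \<in> \<Union>{e}"
    then have "{e' \<in> {e}. x \<in> e'} = {e}" by auto
    then show "image_mset (\<lambda>_. 0) (mset_set {e' \<in> {e}. x \<in> e'}) = mset_set {0..0::int}"
      by simp
  qed
  moreover have "partition_on E ((\<lambda>e. {e}) ` E)"
    by (auto simp: partition_on_def disjoint_def)
  ultimately show "\<exists>k P. partition_on E P \<and> finite P \<and> card P = k \<and>
      (\<forall>F\<in>P. interval_colourable (\<Union>F) F)"
    using assms by (intro exI[of _ "card ((\<lambda>e. {e}) ` E)"] exI[of _ "(\<lambda>e. {e}) ` E"]) auto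
qed

end

theory Submission
  imports Defs
begin

text \<open>
  Let both parts have size \<open>m\<close>, and view edges as pairs. Among all pairs \<open>(S, T)\<close> of \<open>k\<close>-element
  subsets of the parts (for all \<open>k > 0\<close>) choose one maximising \<open>e(S, T) / k\<^bsup>5/3\<^esup>\<close>, and call the maximum
  \<open>D\<close>. Maximality forces large minimum degree and bounds the edges between smaller subsets, so any
  \<open>X \<subseteq> S\<close> and \<open>Y \<subseteq> T\<close> with \<open>|X| + |Y| > k\<close> span at least \<open>(D k\<^bsup>2/3\<^esup> / 30) min(|X|, |Y|)\<close> edges. By Hall's
  theorem one can then remove \<open>r\<close> perfect matchings of \<open>(S, T)\<close> one after the other whenever
  \<open>r \<le> D k\<^bsup>2/3\<^esup> / 30\<close>; numbering the matchings is an interval colouring of their union. As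
  \<open>D k\<^bsup>5/3\<^esup> \<le> k\<^sup>2\<close>, we have \<open>D k\<^bsup>2/3\<^esup> \<ge> D\<^sup>3 \<ge> |E|\<^sup>3 / m\<^sup>5\<close>.

  A largest vertex-disjoint union of such \<open>r\<close>-regular subgraphs leaves fewer than \<open>P\<close> edges
  untouched when \<open>P\<^sup>3 \<ge> 30 r m\<^sup>5\<close>, hence it has at least \<open>r (|E| - P) / (2m)\<close> edges. Removing such
  unions until fewer than \<open>2P\<close> edges remain takes at most \<open>2m\<^sup>3 / (r P)\<close> rounds. The remaining
  edges form at most \<open>2P/d\<close> stars at vertices of degree at least \<open>d\<close> together with \<open>d\<close> star forests.
  With \<open>r \<approx> m\<^bsup>1/3\<^esup>\<close>, \<open>P = 4 m\<^bsup>16/9\<^esup>\<close> and \<open>d \<approx> m\<^bsup>8/9\<^esup>\<close> every term is \<open>O(m\<^bsup>8/9\<^esup>)\<close>.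
\<close>

section \<open>Hall's marriage theorem\<close>

text \<open>Induction on \<open>card S\<close>. If a nonempty proper subset \<open>X\<close> is
  tight, then \<open>X\<close> and \<open>S - X\<close> are matched separately, the latter outside
  the neighbourhood of \<open>X\<close>. If no such subset is tight, an arbitrary edge
  \<open>(x, y)\<close> can be used: every nonempty set of remaining points has a neighbour to spare
  for the loss of \<open>y\<close>.\<close>

lemma hall_marriage:
  assumes "finite S" "finite (R `` S)" "\<And>X. X \<subseteq> S \<Longrightarrow> card X \<le> card (R `` X)"
  shows "\<exists>f. inj_on f S \<and> (\<forall>x\<in>S. (x, f x) \<in> R)"
  using assms
proof (induction "card S" arbitrary: S R rule: less_induct)
  case less
  show ?case
  proof (cases "S = {}")
    case False
    show ?thesis
    proof (cases "\<exists>X. X \<subset> S \<and> X \<noteq> {} \<and> card (R `` X) = card X")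
      case True
      then obtain X where X: "X \<subset> S" "X \<noteq> {}" "card (R `` X) = card X" by blast
      have finX: "finite X" using X(1) less.prems(1) finite_subset by blast
      have "card X < card S" using X(1) less.prems(1) psubset_card_mono by blast
      moreover have "finite (R `` X)"
        using X(1) less.prems(2) by (meson Image_mono finite_subset order.refl psubset_imp_subset)
      ultimately obtain f where f: "inj_on f X" "\<forall>x\<in>X. (x, f x) \<in> R"
        using less.hyps[of X R] less.prems(3) finX X(1) by (metis order.trans psubset_imp_subset)
      define R' where "R' = R - UNIV \<times> R `` X"
      have "card (S - X) < card S"
        using X less.prems(1) by (metis Diff_subset card_seteq diff_le_self double_diff
            Diff_eq_empty_iff linorder_not_le psubset_imp_subset psubsetE)
      moreover have "finite (R' `` (S - X))"
        using less.prems(2) by (rule finite_subset[rotated]) (auto simp: R'_def)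
      moreover have "card Y \<le> card (R' `` Y)" if Y: "Y \<subseteq> S - X" for Y
      proof -
        have finY: "finite Y" using Y less.prems(1) finite_subset by blast
        have fin: "finite (R `` (X \<union> Y))"
          using less.prems(2) by (rule finite_subset[rotated]) (use X Y in auto)
        have "card X + card Y = card (X \<union> Y)"
          using Y finX finY by (subst card_Un_disjoint) auto
        also have "\<dots> \<le> card (R `` (X \<union> Y))" using less.prems(3) X Y by blast
        also have "R `` (X \<union> Y) = R `` X \<union> R' `` Y" by (auto simp: R'_def)
        also have "card \<dots> \<le> card (R `` X) + card (R' `` Y)" by (rule card_Un_le)
        finally show ?thesis using X(3) by simp
      qed
      ultimately obtain g where g: "inj_on g (S - X)" "\<forall>x\<in>S - X. (x, g x) \<in> R'"
        using less.hyps[of "S - X" R'] less.prems(1) by (metis finite_Diff)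
      define h where "h x = (if x \<in> X then f x else g x)" for x
      have "inj_on h S"
        using f g unfolding inj_on_def h_def R'_def by (smt (verit) DiffE DiffI Image_iff UNIV_I mem_Sigma_iff)
      moreover have "\<forall>x\<in>S. (x, h x) \<in> R" using f g by (auto simp: h_def R'_def)
      ultimately show ?thesis by blast
    next
      case no_tight: False
      obtain x where x: "x \<in> S" using False by blast
      have "card (R `` {x}) \<ge> 1" using less.prems(3)[of "{x}"] x by simp
      then have "R `` {x} \<noteq> {}" by force
      then obtain y where y: "(x, y) \<in> R" by blast
      define R' where "R' = R - UNIV \<times> {y}"
      have "card (S - {x}) < card S" using x less.prems(1) by (simp only: card_Diff1_less)
      moreover have "finite (R' `` (S - {x}))"
        using less.prems(2) by (rule finite_subset[rotated]) (auto simp: R'_def)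
      moreover have "card Y \<le> card (R' `` Y)" if Y: "Y \<subseteq> S - {x}" for Y
      proof (cases "Y = {}")
        case False
        have "card (R `` Y) \<noteq> card Y" using no_tight False Y x by blast
        moreover have "card Y \<le> card (R `` Y)" using less.prems(3) Y by blast
        moreover have "R' `` Y = R `` Y - {y}" by (auto simp: R'_def)
        ultimately show ?thesis by (cases "y \<in> R `` Y") auto
      qed simp
      ultimately obtain g where g: "inj_on g (S - {x})" "\<forall>z\<in>S - {x}. (z, g z) \<in> R'"
        using less.hyps[of "S - {x}" R'] less.prems(1) by (metis finite_Diff)
      define h where "h = g(x := y)"
      have "inj_on h S"
        using g unfolding inj_on_def h_def R'_def by (auto simp: fun_upd_def)
      moreover have "\<forall>x\<in>S. (x, h x) \<in> R" using g y by (auto simp: h_def R'_def)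
      ultimately show ?thesis by blast
    qed
  qed simp
qed

section \<open>Averaging and estimates for the power 2/3\<close>

text \<open>Discarding an element of least value does not lower the average; this is repeated until
  \<open>z\<close> elements are left. The averages are compared with denominators cleared, so the
  claim also makes sense for \<open>z = 0\<close>.\<close>

lemma exists_subset_ge_average:
  fixes f :: "'a \<Rightarrow> real"
  assumes "finite X" "z \<le> card X"
  shows "\<exists>X'\<subseteq>X. card X' = z \<and> real z * sum f X \<le> real (card X) * sum f X'"
  using assms
proof (induction "card X - z" arbitrary: X)
  case 0
  then show ?case by (intro exI[of _ X]) auto
next
  case (Suc n)
  show ?case
  proof (cases "z = 0")
    case True
    then show ?thesis by (intro exI[of _ "{}"]) auto
  next
    case False
    have "X \<noteq> {}" using Suc by auto
    then obtain x where x: "x \<in> X" "\<And>y. y \<in> X \<Longrightarrow> f x \<le> f y"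
      using Suc.prems(1) by (metis (no_types, lifting) arg_min_if_finite(1) arg_min_least)
    have card': "card (X - {x}) = card X - 1" using x(1) Suc.prems by simp
    obtain X' where X': "X' \<subseteq> X - {x}" "card X' = z"
      "real z * sum f (X - {x}) \<le> real (card (X - {x})) * sum f X'"
      using Suc.hyps(1)[of "X - {x}"] Suc.hyps(2) Suc.prems card' by fastforce
    have c: "real (card X) \<ge> 2" using Suc.hyps(2) False by linarith
    have cr: "real (card (X - {x})) = real (card X) - 1" using card' c by linarith
    have s: "sum f X = f x + sum f (X - {x})" using x(1) Suc.prems(1) by (simp add: sum.remove)
    have "real (card X) * f x \<le> sum f X"
      using x(2) sum_bounded_below[of X "f x" f] by simp
    then have "(real (card X) - 1) * sum f X \<le> real (card X) * sum f (X - {x})"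
      unfolding s by (simp add: algebra_simps)
    then have "real z * ((real (card X) - 1) * sum f X) \<le> real z * (real (card X) * sum f (X - {x}))"
      by (rule mult_left_mono) simp
    also have "\<dots> = real (card X) * (real z * sum f (X - {x}))" by simp
    also have "\<dots> \<le> real (card X) * ((real (card X) - 1) * sum f X')"
      using X'(3) unfolding cr by (rule mult_left_mono) simp
    finally have "(real (card X) - 1) * (real z * sum f X) \<le> (real (card X) - 1) * (real (card X) * sum f X')"
      by (simp add: algebra_simps)
    then have "real z * sum f X \<le> real (card X) * sum f X'" using c by simp
    then show ?thesis using X' by blast
  qed
qed

text \<open>Reduces the next two estimates to polynomial inequalities.\<close>

lemma powr_two_thirds_le:
  fixes x y :: real
  assumes "0 \<le> x" "0 \<le> y" "x\<^sup>2 \<le> y ^ 3"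
  shows "x powr (2/3) \<le> y"
proof (cases "x = 0 \<or> y = 0")
  case True
  then show ?thesis using assms by auto
next
  case False
  then have pos: "x > 0" "y > 0" using assms by auto
  have "x powr (2/3) = (x\<^sup>2) powr (1/3)"
    using pos by (simp add: powr_powr flip: powr_numeral)
  also have "\<dots> \<le> (y ^ 3) powr (1/3)" using assms by (intro powr_mono2) auto
  also have "\<dots> = y" using pos by (simp add: powr_powr flip: powr_numeral)
  finally show ?thesis .
qed

text \<open>The right-hand side is the tangent at k of the concave function t^(2/3), evaluated at k
  - 1.\<close>

lemma powr_two_thirds_pred:
  fixes k :: real
  assumes "k \<ge> 1"
  shows "(k - 1) powr (2/3) \<le> k powr (2/3) * (1 - 2 / (3 * k))"
proof -
  define u where "u = 1 / k"
  have u: "0 \<le> u" "u \<le> 1" using assms by (auto simp: u_def)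
  \<comment> \<open>This suffices because
    \<open>(1 - 2 * u / 3) ^ 3 - (1 - u) ^ 2 = u ^ 2 * (9 - 8 * u) / 27\<close>.\<close>
  have "8 * u \<le> 9" using u by simp
  then have "u\<^sup>2 * (8 * u) \<le> u\<^sup>2 * 9" by (rule mult_left_mono) simp
  then have "(1 - u)\<^sup>2 \<le> (1 - 2 * u / 3) ^ 3"
    by (simp add: power2_eq_square power3_eq_cube field_simps)
  then have "(1 - u) powr (2/3) \<le> 1 - 2 * u / 3"
    using u by (intro powr_two_thirds_le) auto
  then have "k powr (2/3) * (1 - u) powr (2/3) \<le> k powr (2/3) * (1 - 2 * u / 3)"
    by (intro mult_left_mono) auto
  moreover have "k powr (2/3) * (1 - u) powr (2/3) = (k - 1) powr (2/3)"
    using u assms by (subst powr_mult[symmetric]) (auto simp: u_def right_diff_distrib)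
  ultimately show ?thesis by (simp add: u_def mult.commute)
qed

text \<open>The constant 19/30 is a rational number slightly above 2^(-2/3). It must stay below the
  factor 2/3 of the minimum degree bound, and the gap 2/3 - 19/30 = 1/30 becomes the expansion
  constant. The weight k^(5/3) works because 2/3 exceeds 2^(-2/3).\<close>

lemma powr_two_thirds_half:
  fixes k z :: real
  assumes "0 \<le> z" "2 * z \<le> k"
  shows "z powr (2/3) \<le> 19/30 * k powr (2/3)"
proof (cases "k = 0")
  case False
  have "(z / k) powr (2/3) \<le> 19/30"
  proof (rule powr_two_thirds_le)
    have "(z / k)\<^sup>2 \<le> (1/2)\<^sup>2" using assms False by (intro power_mono) (auto simp: field_simps)
    also have "\<dots> \<le> (19/30 :: real) ^ 3" by (simp add: power2_eq_square power3_eq_cube)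
    finally show "(z / k)\<^sup>2 \<le> (19/30) ^ 3" .
  qed (use assms in auto)
  then show ?thesis using assms False by (simp add: powr_divide field_simps)
qed (use assms in auto)

section \<open>Edge counts and the expansion of an extremal pair\<close>

lemma card_Int_times_eq_sum:
  assumes "finite X" "finite Y"
  shows "card (E \<inter> X \<times> Y) = (\<Sum>x\<in>X. card (E \<inter> {x} \<times> Y))"
proof -
  have "E \<inter> X \<times> Y = (\<Union>x\<in>X. E \<inter> {x} \<times> Y)" by auto
  also have "card \<dots> = (\<Sum>x\<in>X. card (E \<inter> {x} \<times> Y))"
    using assms by (intro card_UN_disjoint) auto
  finally show ?thesis .
qed

lemma card_converse_Int_times: "card (E\<inverse> \<inter> Y \<times> X) = card (E \<inter> X \<times> Y)"
proof -
  have "E\<inverse> \<inter> Y \<times> X = (E \<inter> X \<times> Y)\<inverse>" by auto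
  then show ?thesis by (metis card_inverse)
qed

text \<open>This is what maximality says about the pairs inside \<open>(S, T)\<close>. The weight
  k^(5/3) is split as k times k^(2/3) because for sets of unequal size only the second factor
  follows the smaller one.\<close>

definition balanced_bound :: "real \<Rightarrow> ('a \<times> 'b) set \<Rightarrow> 'a set \<Rightarrow> 'b set \<Rightarrow> bool" where
  "balanced_bound D E S T \<longleftrightarrow> (\<forall>S' T'. S' \<subseteq> S \<longrightarrow> T' \<subseteq> T \<longrightarrow> card S' = card T' \<longrightarrow>
     real (card (E \<inter> S' \<times> T')) \<le> D * (real (card S') * real (card S') powr (2/3)))"

lemma balanced_bound_converse: "balanced_bound D E S T \<Longrightarrow> balanced_bound D (E\<inverse>) T S"
  unfolding balanced_bound_def card_converse_Int_times by metis

text \<open>Averaging over the subsets of \<open>X\<close> of size \<open>card Z\<close> reduces to the balanced case.\<close>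

lemma balanced_bound_unbalanced:
  assumes "balanced_bound D E S T" "finite S" "finite T" "X \<subseteq> S" "Z \<subseteq> T" "card Z \<le> card X"
  shows "real (card (E \<inter> X \<times> Z)) \<le> D * (real (card X) * real (card Z) powr (2/3))"
proof (cases "Z = {}")
  case False
  have fin: "finite X" "finite Z" using assms finite_subset by blast+
  define f where "f x = real (card (E \<inter> {x} \<times> Z))" for x
  obtain X' where X': "X' \<subseteq> X" "card X' = card Z"
    "real (card Z) * sum f X \<le> real (card X) * sum f X'"
    using exists_subset_ge_average[OF fin(1) assms(6)] by blast
  have z: "real (card Z) > 0" using False fin by (simp add: card_gt_0_iff)
  have "sum f X' = real (card (E \<inter> X' \<times> Z))"
    using card_Int_times_eq_sum[of X' Z E] fin X'(1) finite_subset by (fastforce simp: f_def)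
  also have "\<dots> \<le> D * (real (card Z) * real (card Z) powr (2/3))"
    using assms X' unfolding balanced_bound_def by (metis order.trans)
  finally have s: "sum f X' \<le> D * (real (card Z) * real (card Z) powr (2/3))" .
  have "real (card Z) * real (card (E \<inter> X \<times> Z)) = real (card Z) * sum f X"
    using card_Int_times_eq_sum[of X Z E] fin by (simp add: f_def)
  also have "\<dots> \<le> real (card X) * sum f X'" by fact
  also have "\<dots> \<le> real (card X) * (D * (real (card Z) * real (card Z) powr (2/3)))"
    using s by (rule mult_left_mono) simp
  finally have "real (card Z) * real (card (E \<inter> X \<times> Z)) \<le>
      real (card Z) * (D * (real (card X) * real (card Z) powr (2/3)))" by (simp add: algebra_simps)
  then show ?thesis using z by simp
qed simp

text \<open>Without \<open>x\<close> at most D k (k - 1)^(2/3) of the D k^(5/3) edges remain. The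
  tangent estimate turns the difference into a lower bound for the degree of
  \<open>x\<close>.\<close>

lemma balanced_bound_degree:
  assumes bb: "balanced_bound D E S T" and fin: "finite S" "finite T" "card S = card T"
    and e: "real (card (E \<inter> S \<times> T)) = D * (real (card S) * real (card S) powr (2/3))"
    and x: "x \<in> S" and D: "D \<ge> 0"
  shows "2/3 * D * real (card S) powr (2/3) \<le> real (card (E \<inter> {x} \<times> T))"
proof -
  define k where "k = real (card S)"
  have k1: "k \<ge> 1" using x fin unfolding k_def by (metis One_nat_def Suc_leI card_gt_0_iff empty_iff of_nat_1 of_nat_le_iff)
  have cx: "real (card (S - {x})) = k - 1" using x fin k1 unfolding k_def by (simp add: of_nat_diff)
  have "real (card (E \<inter> (S - {x}) \<times> T)) = real (card (E\<inverse> \<inter> T \<times> (S - {x})))"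
    by (simp add: card_converse_Int_times)
  \<comment> \<open>The converse is used because here the smaller set lies on the side of
    \<open>S\<close>.\<close>
  also have "\<dots> \<le> D * (real (card T) * real (card (S - {x})) powr (2/3))"
    using fin by (intro balanced_bound_unbalanced[OF balanced_bound_converse[OF bb]])
      (simp_all add: card_mono[OF fin(1)] flip: fin(3))
  also have "\<dots> = D * k * (k - 1) powr (2/3)" using fin(3) cx by (simp add: k_def)
  also have "\<dots> \<le> D * k * (k powr (2/3) * (1 - 2 / (3 * k)))"
    using powr_two_thirds_pred[OF k1] D k1 by (intro mult_left_mono) auto
  also have "\<dots> = D * (k * k powr (2/3)) - 2/3 * D * k powr (2/3)"
    using k1 by (simp add: field_simps)
  finally have "real (card (E \<inter> (S - {x}) \<times> T)) \<le> D * (k * k powr (2/3)) - 2/3 * D * k powr (2/3)" .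
  moreover have "card (E \<inter> S \<times> T) = card (E \<inter> {x} \<times> T) + card (E \<inter> (S - {x}) \<times> T)"
    using x fin by (simp add: card_Int_times_eq_sum[of S] card_Int_times_eq_sum[of "S - {x}"] sum.remove)
  ultimately show ?thesis using e by (simp add: k_def)
qed

text \<open>The edges from \<open>X\<close> to \<open>Y\<close> are those to \<open>T\<close> minus
  those to \<open>Z = T - Y\<close>. The minimum degree gives at least 2/3 D k^(2/3) |X| edges to
  \<open>T\<close>. The size hypotheses make \<open>Z\<close> smaller than both \<open>X\<close> and
  k/2, so at most 19/30 D k^(2/3) |X| edges go to \<open>Z\<close>.\<close>

lemma balanced_bound_expansion_aux:
  assumes bb: "balanced_bound D E S T" and fin: "finite S" "finite T" "card S = card T"
    and e: "real (card (E \<inter> S \<times> T)) = D * (real (card S) * real (card S) powr (2/3))"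
    and D: "D \<ge> 0" and XY: "X \<subseteq> S" "Y \<subseteq> T" "card S < card X + card Y" "card X \<le> card Y"
  shows "D * real (card S) powr (2/3) / 30 * real (card X) \<le> real (card (E \<inter> X \<times> Y))"
proof -
  define k where "k = real (card S)"
  have finX: "finite X" and finY: "finite Y" using XY fin finite_subset by blast+
  define Z where "Z = T - Y"
  have cZ: "card Z = card T - card Y" "card Y \<le> card T"
    using XY fin by (auto simp: Z_def card_Diff_subset finY card_mono)
  have split: "card (E \<inter> X \<times> T) = card (E \<inter> X \<times> Y) + card (E \<inter> X \<times> Z)"
  proof -
    have "E \<inter> X \<times> T = E \<inter> X \<times> Y \<union> E \<inter> X \<times> Z" using XY by (auto simp: Z_def)
    moreover have "finite (X \<times> Y)" "finite (X \<times> Z)" using finX finY fin by (auto simp: Z_def)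
    ultimately show ?thesis by (simp add: card_Un_disjoint Z_def disjoint_iff)
  qed
  have "real (card X) * (2/3 * D * k powr (2/3)) \<le> (\<Sum>x\<in>X. real (card (E \<inter> {x} \<times> T)))"
    using balanced_bound_degree[OF bb fin e _ D] XY(1) unfolding k_def
    by (intro sum_bounded_below) auto
  also have "\<dots> = real (card (E \<inter> X \<times> T))" by (simp add: card_Int_times_eq_sum[OF finX fin(2)])
  finally have lower: "real (card X) * (2/3 * D * k powr (2/3)) \<le> real (card (E \<inter> X \<times> T))" .
  have "real (card (E \<inter> X \<times> Z)) \<le> D * (real (card X) * real (card Z) powr (2/3))"
    using cZ XY fin by (intro balanced_bound_unbalanced[OF bb]) (auto simp: Z_def)
  also have "\<dots> \<le> D * (real (card X) * (19/30 * k powr (2/3)))"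
    using cZ XY fin D unfolding k_def
    by (intro mult_left_mono powr_two_thirds_half) auto
  finally show ?thesis using lower split by (simp add: k_def algebra_simps)
qed

lemma balanced_bound_expansion:
  assumes bb: "balanced_bound D E S T" and fin: "finite S" "finite T" "card S = card T"
    and e: "real (card (E \<inter> S \<times> T)) = D * (real (card S) * real (card S) powr (2/3))"
    and D: "D \<ge> 0" and XY: "X \<subseteq> S" "Y \<subseteq> T" "card S < card X + card Y"
  shows "D * real (card S) powr (2/3) / 30 * real (min (card X) (card Y)) \<le> real (card (E \<inter> X \<times> Y))"
proof (cases "card X \<le> card Y")
  case True
  then show ?thesis using balanced_bound_expansion_aux[OF assms True] by simp
next
  case False
  have "D * real (card T) powr (2/3) / 30 * real (card Y) \<le> real (card (E\<inverse> \<inter> Y \<times> X))"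
    using False XY fin D e
    by (intro balanced_bound_expansion_aux[OF balanced_bound_converse[OF bb]])
      (auto simp: card_converse_Int_times)
  then show ?thesis using False fin by (simp add: card_converse_Int_times)
qed

section \<open>Regular subgraphs from expansion\<close>

text \<open>For \<open>F\<close> inside \<open>S \<times> T\<close> the colour classes are
  \<open>r\<close> disjoint perfect matchings of \<open>(S, T)\<close>.\<close>

definition factor_colouring :: "nat \<Rightarrow> ('a \<times> 'b \<Rightarrow> nat) \<Rightarrow> ('a \<times> 'b) set \<Rightarrow> 'a set \<Rightarrow> 'b set \<Rightarrow> bool" where
  "factor_colouring r c F S T \<longleftrightarrow>
     (\<forall>a\<in>S. bij_betw c {e \<in> F. fst e = a} {..<r}) \<and> (\<forall>b\<in>T. bij_betw c {e \<in> F. snd e = b} {..<r})"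

text \<open>Only vertices met by \<open>F\<close> are constrained, so the empty set qualifies and
  vertex-disjoint unions can be formed.\<close>

definition one_factorable :: "nat \<Rightarrow> ('a \<times> 'b) set \<Rightarrow> bool" where
  "one_factorable r F \<longleftrightarrow> (\<exists>c. factor_colouring r c F (fst ` F) (snd ` F))"

text \<open>
  If Hall's condition fails for \<open>X\<close> after \<open>j\<close> matchings have been removed, then all edges of \<open>E\<close>
  between \<open>X\<close> and the vertices of \<open>T\<close> it no longer reaches lie in these matchings, which is too few.
\<close>

lemma expander_factor_colouring:
  assumes fin: "finite S" "finite T" "card S = card T"
    and exp: "\<And>X Y. X \<subseteq> S \<Longrightarrow> Y \<subseteq> T \<Longrightarrow> card S < card X + card Y \<Longrightarrow>
      r * min (card X) (card Y) \<le> card (E \<inter> X \<times> Y)"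
    and "j \<le> r"
  shows "\<exists>F c. F \<subseteq> E \<inter> S \<times> T \<and> factor_colouring j c F S T"
  using \<open>j \<le> r\<close>
proof (induction j)
  case 0
  then show ?case by (intro exI[of _ "{}"]) (auto simp: factor_colouring_def bij_betw_def)
next
  case (Suc j)
  then obtain F c where F: "F \<subseteq> E \<inter> S \<times> T" "factor_colouring j c F S T" by auto
  have finF: "finite F" using F(1) fin by (meson finite_Int finite_SigmaI finite_subset)
  have degF: "card {e \<in> F. fst e = a} = j" if "a \<in> S" for a
    using F(2) that bij_betw_same_card unfolding factor_colouring_def by fastforce
  have degF': "card {e \<in> F. snd e = b} = j" if "b \<in> T" for b
    using F(2) that bij_betw_same_card unfolding factor_colouring_def by fastforce
  define R where "R = (E - F) \<inter> S \<times> T"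
  have "card X \<le> card (R `` X)" if X: "X \<subseteq> S" for X
  proof (rule ccontr)
    assume less: "\<not> card X \<le> card (R `` X)"
    have RX: "R `` X \<subseteq> T" by (auto simp: R_def)
    define Y where "Y = T - R `` X"
    have Y: "Y \<subseteq> T" "card Y = card T - card (R `` X)"
      using RX fin by (auto simp: Y_def card_Diff_subset finite_subset)
    have finXY: "finite X" "finite Y" using X Y fin finite_subset by blast+
    have "card (R `` X) \<le> card T" "card X \<le> card S"
      using card_mono[OF fin(2) RX] card_mono[OF fin(1) X] .
    then have gt: "card S < card X + card Y" and Ypos: "card Y > 0" and Xpos: "card X > 0"
      using less Y(2) fin(3) by linarith+
    have "r * min (card X) (card Y) \<le> card (E \<inter> X \<times> Y)" using exp X Y gt by blast
    also have "E \<inter> X \<times> Y = F \<inter> X \<times> Y" using X F(1) by (auto simp: Y_def R_def)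
    finally have lower: "r * min (card X) (card Y) \<le> card (F \<inter> X \<times> Y)" .
    have "card (F \<inter> X \<times> Y) \<le> (\<Sum>x\<in>X. j)"
      unfolding card_Int_times_eq_sum[OF finXY]
    proof (intro sum_mono)
      fix x assume "x \<in> X"
      have "card (F \<inter> {x} \<times> Y) \<le> card {e \<in> F. fst e = x}" using finF by (intro card_mono) auto
      then show "card (F \<inter> {x} \<times> Y) \<le> j" using degF[of x] \<open>x \<in> X\<close> X by auto
    qed
    moreover have "card (F \<inter> X \<times> Y) \<le> (\<Sum>y\<in>Y. j)"
    proof -
      have "card (F \<inter> X \<times> Y) = card (F\<inverse> \<inter> Y \<times> X)" by (simp add: card_converse_Int_times)
      also have "\<dots> \<le> (\<Sum>y\<in>Y. j)"
        unfolding card_Int_times_eq_sum[OF finXY(2,1)]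
      proof (intro sum_mono)
        fix y assume "y \<in> Y"
        then have "y \<in> T" using Y by blast
        have "card (F\<inverse> \<inter> {y} \<times> X) = card (F \<inter> X \<times> {y})" by (rule card_converse_Int_times)
        also have "\<dots> \<le> card {e \<in> F. snd e = y}" using finF by (intro card_mono) auto
        finally show "card (F\<inverse> \<inter> {y} \<times> X) \<le> j" using degF'[OF \<open>y \<in> T\<close>] by simp
      qed
      finally show ?thesis .
    qed
    \<comment> \<open>All degrees in \<open>F\<close> are \<open>j\<close>, so the smaller of the
      two sets limits the count; \<open>j < r\<close> then contradicts the expansion.\<close>
    ultimately have "card (F \<inter> X \<times> Y) \<le> j * min (card X) (card Y)"
      by (simp add: min_def mult.commute)
    with lower have "r * min (card X) (card Y) \<le> j * min (card X) (card Y)" by linarith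
    then show False using Suc.prems Xpos Ypos by simp
  qed
  moreover have "finite (R `` S)" using fin by (rule_tac finite_subset[of _ T]) (auto simp: R_def)
  ultimately obtain f where f: "inj_on f S" "\<And>x. x \<in> S \<Longrightarrow> (x, f x) \<in> R"
    using hall_marriage[OF fin(1), of R] by blast
  have "f ` S \<subseteq> T" using f(2) by (auto simp: R_def)
  \<comment> \<open>Equal sizes make the new matching perfect, so each vertex of \<open>T\<close>
    also gains exactly one edge.\<close>
  then have fS: "f ` S = T" using f(1) fin by (simp add: card_image card_subset_eq)
  define F' where "F' = F \<union> (\<lambda>x. (x, f x)) ` S"
  define c' where "c' e = (if e \<in> F then c e else j)" for e
  have ext: "bij_betw c' Z {..<Suc j}"
    if "bij_betw c W {..<j}" "W \<subseteq> F" "Z = W \<union> {e}" "e \<notin> F" for W Z e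
  proof -
    have "bij_betw c' W {..<j}"
      using that(1,2) by (subst bij_betw_cong[of _ _ c]) (auto simp: c'_def)
    then have "bij_betw c' (W \<union> {e}) ({..<j} \<union> {c' e})"
      using that(2,4) by (intro notIn_Un_bij_betw) (auto simp: c'_def)
    then show ?thesis using that(3,4) by (simp add: c'_def lessThan_Suc)
  qed
  have "bij_betw c' {e \<in> F'. fst e = a} {..<Suc j}" if "a \<in> S" for a
    using f(2)[OF that] that F(2)
    by (intro ext[of "{e \<in> F. fst e = a}" _ "(a, f a)"]) (auto simp: F'_def R_def factor_colouring_def)
  moreover have "bij_betw c' {e \<in> F'. snd e = b} {..<Suc j}" if b: "b \<in> T" for b
  proof -
    obtain a where a: "a \<in> S" "b = f a" using b fS by auto
    have "(\<lambda>x. (x, f x)) ` S \<inter> {e. snd e = b} = {(a, b)}"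
      using a f(1) by (auto simp: inj_on_def)
    then have "{e \<in> F'. snd e = b} = {e \<in> F. snd e = b} \<union> {(a, b)}" by (auto simp: F'_def)
    then show ?thesis using f(2)[OF a(1)] a b F(2)
      by (intro ext[of "{e \<in> F. snd e = b}" _ "(a, b)"]) (auto simp: R_def factor_colouring_def)
  qed
  moreover have "F' \<subseteq> E \<inter> S \<times> T" using F(1) f(2) by (auto simp: F'_def R_def)
  ultimately show ?case unfolding factor_colouring_def by blast
qed

lemma powr_two_thirds_power3: "x \<ge> 0 \<Longrightarrow> (x powr (2/3)) ^ 3 = (x::real)\<^sup>2"
  by (cases "x = 0") (auto simp: powr_powr simp flip: powr_numeral)

lemma exists_one_factorable_subset:
  assumes fin: "finite A" "finite B" "card A = card B" and E: "E \<subseteq> A \<times> B" "E \<noteq> {}"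
    and "r > 0" and dense: "30 * real r * real (card A) ^ 5 \<le> real (card E) ^ 3"
  shows "\<exists>F\<subseteq>E. F \<noteq> {} \<and> one_factorable r F"
proof -
  \<comment> \<open>Excluding empty sets keeps the weight \<open>w\<close> positive on
    \<open>Q\<close>.\<close>
  define Q where "Q = {(S, T). S \<subseteq> A \<and> T \<subseteq> B \<and> card S = card T \<and> S \<noteq> {}}"
  define w where "w k = k * k powr (2/3)" for k :: real
  define \<phi> where "\<phi> = (\<lambda>(S, T). real (card (E \<inter> S \<times> T)) / w (real (card S)))"
  have A: "A \<noteq> {}" using E by auto
  have "Q \<subseteq> Pow A \<times> Pow B" by (auto simp: Q_def)
  then have "finite Q" using fin finite_subset by blast
  moreover have AB: "(A, B) \<in> Q" using fin A by (auto simp: Q_def)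
  ultimately obtain q where q: "q \<in> Q" "\<And>p. p \<in> Q \<Longrightarrow> \<phi> p \<le> \<phi> q"
    using obtains_Max[of "\<phi> ` Q"] by (metis (no_types, lifting) Max_ge empty_iff finite_imageI image_iff image_is_empty)
  obtain S T where ST: "q = (S, T)" by fastforce
  define D where "D = \<phi> (S, T)"
  define k where "k = real (card S)"
  have S: "S \<subseteq> A" "T \<subseteq> B" "card S = card T" "S \<noteq> {}" using q(1) by (auto simp: ST Q_def)
  have finST: "finite S" "finite T" using S fin finite_subset by blast+
  have k: "k > 0" using S(4) finST by (simp add: k_def card_gt_0_iff)
  have wpos: "w x > 0" if "x > 0" for x using that by (simp add: w_def)
  have D0: "D \<ge> 0" by (simp add: D_def \<phi>_def w_def)
  have bb: "balanced_bound D E S T"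
    unfolding balanced_bound_def
  proof (intro allI impI)
    fix S' T' assume S': "S' \<subseteq> S" "T' \<subseteq> T" "card S' = card T'"
    show "real (card (E \<inter> S' \<times> T')) \<le> D * (real (card S') * real (card S') powr (2/3))"
    proof (cases "S' = {}")
      case False
      then have "(S', T') \<in> Q" using S' S by (auto simp: Q_def)
      then have "real (card (E \<inter> S' \<times> T')) / w (real (card S')) \<le> D"
        using q(2) by (fastforce simp: D_def ST \<phi>_def)
      moreover have "w (real (card S')) > 0"
        using False S'(1) finST(1) by (intro wpos) (metis card_gt_0_iff finite_subset of_nat_0_less_iff)
      ultimately show ?thesis by (simp add: field_simps w_def)
    qed simp
  qed
  have e: "real (card (E \<inter> S \<times> T)) = D * (k * k powr (2/3))"
    using k finST by (simp add: D_def \<phi>_def k_def w_def card_gt_0_iff)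
  have "30 * real r \<le> D * k powr (2/3)"
  proof -
    define m where "m = real (card A)"
    define u where "u = k powr (2/3)"
    have m: "m > 0" using A fin(1) unfolding m_def by (metis card_gt_0_iff of_nat_0_less_iff)
    \<comment> \<open>Comparing the maximum with the whole pair \<open>(A, B)\<close> bounds
      \<open>D\<close> from below.\<close>
    have "E \<inter> A \<times> B = E" using E by blast
    then have "real (card E) / w m \<le> D"
      using q(2)[OF AB] by (simp add: D_def ST \<phi>_def m_def)
    then have "(real (card E) / w m) ^ 3 \<le> D ^ 3"
      using m wpos by (intro power_mono) (auto simp: less_imp_le)
    moreover have "w m ^ 3 = m ^ 5"
      using m unfolding w_def by (simp add: power_mult_distrib powr_two_thirds_power3 flip: power_add)
    moreover have "30 * real r \<le> real (card E) ^ 3 / m ^ 5"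
      using dense m by (simp add: m_def field_simps)
    ultimately have D3: "30 * real r \<le> D ^ 3" by (simp add: power_divide)
    have u: "u > 0" using k by (simp add: u_def)
    \<comment> \<open>The unknown size \<open>k\<close> is eliminated here: at most k^2 edges give
      \<open>D * u \<le> k\<close>, and since k^2 = u^3 this becomes D^2 \<le> u, hence D^3 \<le> D
      u.\<close>
    have "card (E \<inter> S \<times> T) \<le> card (S \<times> T)" using finST by (intro card_mono) auto
    then have "real (card (E \<inter> S \<times> T)) \<le> k * k"
      using S(3) by (simp add: k_def card_cartesian_product flip: of_nat_mult)
    then have "D * u \<le> k" using k unfolding e u_def by simp
    then have "(D * u)\<^sup>2 \<le> k\<^sup>2" using D0 u by (intro power_mono) auto
    also have "\<dots> = u ^ 3" using k by (simp add: u_def powr_two_thirds_power3)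
    finally have "u\<^sup>2 * D\<^sup>2 \<le> u\<^sup>2 * u" by (simp add: power2_eq_square power3_eq_cube algebra_simps)
    then have "D\<^sup>2 \<le> u" using u by simp
    then have "D * D\<^sup>2 \<le> D * u" using D0 by (rule mult_left_mono)
    then show ?thesis using D3 by (simp add: u_def power2_eq_square power3_eq_cube)
  qed
  then have r: "real r \<le> D * k powr (2/3) / 30" by simp
  have "r * min (card X) (card Y) \<le> card (E \<inter> X \<times> Y)"
    if XY: "X \<subseteq> S" "Y \<subseteq> T" "card S < card X + card Y" for X Y
  proof -
    have "real r * real (min (card X) (card Y)) \<le> D * k powr (2/3) / 30 * real (min (card X) (card Y))"
      using r by (rule mult_right_mono) simp
    also have "\<dots> \<le> real (card (E \<inter> X \<times> Y))"
      unfolding k_def using balanced_bound_expansion[OF bb finST S(3) _ D0 XY] e by (simp add: k_def)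
    finally have "real (r * min (card X) (card Y)) \<le> real (card (E \<inter> X \<times> Y))" by simp
    then show ?thesis using of_nat_le_iff by blast
  qed
  then obtain F c where F: "F \<subseteq> E \<inter> S \<times> T" "factor_colouring r c F S T"
    using expander_factor_colouring[OF finST S(3), of r E r] by auto
  obtain a where a: "a \<in> S" using S(4) by blast
  have "bij_betw c {e \<in> F. fst e = a} {..<r}" using F(2) a by (simp add: factor_colouring_def)
  then have "F \<noteq> {}" using \<open>r > 0\<close> by (auto simp: bij_betw_def)
  moreover have "one_factorable r F"
    unfolding one_factorable_def using F by (intro exI[of _ c]) (auto simp: factor_colouring_def)
  ultimately show ?thesis using F(1) by blast
qed

section \<open>Large vertex-disjoint unions of regular subgraphs\<close>

text \<open>Every vertex meets edges of only one of the two sets, so the colourings glue.\<close>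

lemma one_factorable_Un:
  assumes "one_factorable r F" "one_factorable r G"
    and disj: "fst ` F \<inter> fst ` G = {}" "snd ` F \<inter> snd ` G = {}"
  shows "one_factorable r (F \<union> G)"
proof -
  obtain c d where c: "factor_colouring r c F (fst ` F) (snd ` F)"
    and d: "factor_colouring r d G (fst ` G) (snd ` G)"
    using assms unfolding one_factorable_def by blast
  define c' where "c' e = (if e \<in> F then c e else d e)" for e
  have c'_F: "bij_betw c' Z {..<r}" if "bij_betw c Z {..<r}" "Z \<subseteq> F" for Z
    using that by (subst bij_betw_cong[of _ _ c]) (auto simp: c'_def)
  have c'_G: "bij_betw c' Z {..<r}" if "bij_betw d Z {..<r}" "Z \<inter> F = {}" for Z
    using that by (subst bij_betw_cong[of _ _ d]) (auto simp: c'_def)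
  have "factor_colouring r c' (F \<union> G) (fst ` (F \<union> G)) (snd ` (F \<union> G))"
    unfolding factor_colouring_def
  proof (intro conjI ballI)
    fix a assume "a \<in> fst ` (F \<union> G)"
    then consider "a \<in> fst ` F" "a \<notin> fst ` G" | "a \<in> fst ` G" "a \<notin> fst ` F" using disj by blast
    then show "bij_betw c' {e \<in> F \<union> G. fst e = a} {..<r}"
    proof cases
      case 1
      then have "{e \<in> F \<union> G. fst e = a} = {e \<in> F. fst e = a}"
        by (intro Collect_cong) (metis UnE UnI1 UnI2 imageI)
      then show ?thesis using c 1(1) by (auto simp: factor_colouring_def intro!: c'_F)
    next
      case 2
      then have "{e \<in> F \<union> G. fst e = a} = {e \<in> G. fst e = a}"
        by (intro Collect_cong) (metis UnE UnI1 UnI2 imageI)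
      moreover have "{e \<in> G. fst e = a} \<inter> F = {}" using 2(2) by force
      moreover have "bij_betw d {e \<in> G. fst e = a} {..<r}"
        using d 2(1) by (auto simp: factor_colouring_def)
      ultimately show ?thesis using c'_G by metis
    qed
  next
    fix a assume "a \<in> snd ` (F \<union> G)"
    then consider "a \<in> snd ` F" "a \<notin> snd ` G" | "a \<in> snd ` G" "a \<notin> snd ` F" using disj by blast
    then show "bij_betw c' {e \<in> F \<union> G. snd e = a} {..<r}"
    proof cases
      case 1
      then have "{e \<in> F \<union> G. snd e = a} = {e \<in> F. snd e = a}"
        by (intro Collect_cong) (metis UnE UnI1 UnI2 imageI)
      then show ?thesis using c 1(1) by (auto simp: factor_colouring_def intro!: c'_F)
    next
      case 2
      then have "{e \<in> F \<union> G. snd e = a} = {e \<in> G. snd e = a}"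
        by (intro Collect_cong) (metis UnE UnI1 UnI2 imageI)
      moreover have "{e \<in> G. snd e = a} \<inter> F = {}" using 2(2) by force
      moreover have "bij_betw d {e \<in> G. snd e = a} {..<r}"
        using d 2(1) by (auto simp: factor_colouring_def)
      ultimately show ?thesis using c'_G by metis
    qed
  qed
  then show ?thesis unfolding one_factorable_def by blast
qed

lemma one_factorable_card:
  assumes "one_factorable r F" "finite F"
  shows "card F = r * card (fst ` F)" "card F = r * card (snd ` F)"
proof -
  obtain c where c: "factor_colouring r c F (fst ` F) (snd ` F)"
    using assms unfolding one_factorable_def by blast
  have "card F = (\<Sum>a\<in>fst ` F. card {e \<in> F. fst e = a})"
    using sum.image_gen[OF assms(2), of "\<lambda>_. 1::nat" fst] by simp
  also have "\<dots> = (\<Sum>a\<in>fst ` F. r)"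
    using c bij_betw_same_card unfolding factor_colouring_def by (intro sum.cong) fastforce+
  finally show "card F = r * card (fst ` F)" by simp
  have "card F = (\<Sum>a\<in>snd ` F. card {e \<in> F. snd e = a})"
    using sum.image_gen[OF assms(2), of "\<lambda>_. 1::nat" snd] by simp
  also have "\<dots> = (\<Sum>a\<in>snd ` F. r)"
    using c bij_betw_same_card unfolding factor_colouring_def by (intro sum.cong) fastforce+
  finally show "card F = r * card (snd ` F)" by simp
qed

text \<open>Take \<open>F\<close> with the most edges. Edges of \<open>E\<close> missing all
  vertices of \<open>F\<close> number fewer than \<open>P\<close>, since otherwise they contain a
  further piece to add. All other edges meet one of the \<open>card F / r\<close> vertices that
  \<open>F\<close> covers on each side, and each vertex lies on at most \<open>card A\<close>
  edges.\<close>

lemma exists_large_one_factorable_subset: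
  fixes P :: real
  assumes fin: "finite A" "finite B" "card A = card B" and E: "E \<subseteq> A \<times> B"
    and "r > 0" "P > 0" and P: "30 * real r * real (card A) ^ 5 \<le> P ^ 3"
  shows "\<exists>F\<subseteq>E. one_factorable r F \<and>
    real r * (real (card E) - P) \<le> 2 * real (card A) * real (card F)"
proof -
  have finE: "finite E" using E fin by (meson finite_SigmaI finite_subset)
  have "one_factorable r {}" by (simp add: one_factorable_def factor_colouring_def)
  then have "\<exists>F. F \<subseteq> E \<and> one_factorable r F" by blast
  moreover have "\<forall>F. F \<subseteq> E \<and> one_factorable r F \<longrightarrow> card F \<le> card E"
    using finE by (simp add: card_mono)
  ultimately obtain F where F: "F \<subseteq> E" "one_factorable r F"
    and max: "\<And>G. G \<subseteq> E \<Longrightarrow> one_factorable r G \<Longrightarrow> card G \<le> card F"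
    using ex_has_greatest_nat[of "\<lambda>F. F \<subseteq> E \<and> one_factorable r F" _ card "Suc (card E)"]
    by (metis less_Suc_eq_le)
  have finF: "finite F" using F finE finite_subset by blast
  define m where "m = real (card A)"
  define E' where "E' = {e \<in> E. fst e \<notin> fst ` F \<and> snd e \<notin> snd ` F}"
  have "real (card E') < P"
  proof (rule ccontr)
    assume "\<not> real (card E') < P"
    then have ge: "P \<le> real (card E')" by simp
    then have "E' \<noteq> {}" using \<open>P > 0\<close> by auto
    moreover have "30 * real r * real (card A) ^ 5 \<le> real (card E') ^ 3"
      using P power_mono[OF ge, of 3] \<open>P > 0\<close> by linarith
    moreover have "E' \<subseteq> A \<times> B" using E by (auto simp: E'_def)
    ultimately obtain G where G: "G \<subseteq> E'" "G \<noteq> {}" "one_factorable r G"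
      using exists_one_factorable_subset[OF fin _ _ \<open>r > 0\<close>] by blast
    have sub: "F \<union> G \<subseteq> E" using F G by (auto simp: E'_def)
    have "fst e \<notin> fst ` F" "snd e \<notin> snd ` F" if "e \<in> G" for e
      using G(1) that unfolding E'_def by auto
    then have disj: "fst ` F \<inter> fst ` G = {}" "snd ` F \<inter> snd ` G = {}"
      by (metis disjoint_iff imageE)+
    have "card (F \<union> G) \<le> card F" using max[OF sub one_factorable_Un[OF F(2) G(3) disj]] .
    moreover have "F \<inter> G = {}" using disj(1) by (metis disjoint_iff imageI)
    moreover have "finite G" using sub finE finite_subset by blast
    ultimately show False using G(2) finF by (simp add: card_Un_disjoint)
  qed
  moreover have "real (card E) \<le> real (card E') + m * (real (card (fst ` F)) + real (card (snd ` F)))"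
  proof -
    have "E \<subseteq> E' \<union> (fst ` F \<times> B \<union> A \<times> snd ` F)"
    proof
      fix e assume "e \<in> E"
      moreover have "fst e \<in> A" "snd e \<in> B" using E calculation by auto
      ultimately show "e \<in> E' \<union> (fst ` F \<times> B \<union> A \<times> snd ` F)"
        by (cases "e \<in> E'") (simp_all add: E'_def mem_Times_iff)
    qed
    then have "card E \<le> card (E' \<union> (fst ` F \<times> B \<union> A \<times> snd ` F))"
      using finE finF fin by (intro card_mono) (auto simp: E'_def)
    also have "\<dots> \<le> card E' + (card (fst ` F \<times> B) + card (A \<times> snd ` F))"
      by (meson add_left_mono card_Un_le order_trans)
    also have "\<dots> = card E' + card A * (card (fst ` F) + card (snd ` F))"
      using fin(3) by (simp add: card_cartesian_product algebra_simps)
    finally have "real (card E) \<le> real (card E' + card A * (card (fst ` F) + card (snd ` F)))"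
      by (rule of_nat_mono)
    then show ?thesis by (simp add: m_def)
  qed
  ultimately have "real (card E) - P \<le> m * (real (card (fst ` F)) + real (card (snd ` F)))" by linarith
  then have "real r * (real (card E) - P) \<le> real r * (m * (real (card (fst ` F)) + real (card (snd ` F))))"
    by (rule mult_left_mono) simp
  also have "\<dots> = m * (real (r * card (fst ` F)) + real (r * card (snd ` F)))" by (simp add: algebra_simps)
  also have "\<dots> = 2 * m * real (card F)"
    by (simp flip: one_factorable_card[OF F(2) finF])
  finally show ?thesis using F unfolding m_def by blast
qed

section \<open>Decompositions into interval colourable sets of pairs\<close>

text \<open>Interval colourability for edges kept as ordered pairs; a bijection onto the interval
  takes the place of the multiset equation.\<close>

definition pair_colourable :: "('a \<times> 'b) set \<Rightarrow> bool" where
  "pair_colourable F \<longleftrightarrow> (\<exists>c :: 'a \<times> 'b \<Rightarrow> int.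
     (\<forall>a\<in>fst ` F. \<exists>l h. bij_betw c {e \<in> F. fst e = a} {l..h}) \<and>
     (\<forall>b\<in>snd ` F. \<exists>l h. bij_betw c {e \<in> F. snd e = b} {l..h}))"

text \<open>Labels are used instead of a partition: classes may be empty, so \<open>k\<close> is
  only an upper bound and the numbers of classes simply add up.\<close>

definition decomposable :: "('a \<times> 'b) set \<Rightarrow> nat \<Rightarrow> bool" where
  "decomposable E k \<longleftrightarrow> (\<exists>g. (\<forall>e\<in>E. g e < k) \<and> (\<forall>i. pair_colourable {e \<in> E. g e = i}))"

lemma bij_betw_int_lessThan:
  assumes "bij_betw c X {..<n :: nat}"
  shows "bij_betw (\<lambda>e. int (c e)) X {0..int n - 1}"
proof -
  have "bij_betw int {..<n} {0..int n - 1}"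
    unfolding bij_betw_def by (auto simp: image_int_atLeastLessThan lessThan_atLeast0)
  from bij_betw_trans[OF assms this] show ?thesis by (simp add: comp_def)
qed

lemma one_factorable_imp_pair_colourable: "one_factorable r F \<Longrightarrow> pair_colourable F"
  unfolding one_factorable_def pair_colourable_def factor_colouring_def
  using bij_betw_int_lessThan by meson

lemma pair_colourable_empty: "pair_colourable {}"
  by (simp add: pair_colourable_def)

lemma bij_betw_swap:
  "bij_betw prod.swap {e \<in> F. fst e = a} {e \<in> F\<inverse>. snd e = a}"
  "bij_betw prod.swap {e \<in> F. snd e = b} {e \<in> F\<inverse>. fst e = b}"
  by (rule bij_betwI[of _ _ _ prod.swap]; auto)+

lemma pair_colourable_converse:
  assumes "pair_colourable (F\<inverse>)"
  shows "pair_colourable F"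
proof -
  obtain c :: "_ \<Rightarrow> int" where
    c: "\<forall>a\<in>fst ` F\<inverse>. \<exists>l h. bij_betw c {e \<in> F\<inverse>. fst e = a} {l..h}"
      "\<forall>b\<in>snd ` F\<inverse>. \<exists>l h. bij_betw c {e \<in> F\<inverse>. snd e = b} {l..h}"
    using assms unfolding pair_colourable_def by blast
  have img: "fst ` F\<inverse> = snd ` F" "snd ` F\<inverse> = fst ` F" by force+
  show ?thesis
    unfolding pair_colourable_def
  proof (intro exI[of _ "c \<circ> prod.swap"] conjI ballI)
    fix a assume "a \<in> fst ` F"
    then obtain l h where "bij_betw c {e \<in> F\<inverse>. snd e = a} {l..h}" using c(2) img(2) by metis
    from bij_betw_trans[OF bij_betw_swap(1) this]
    show "\<exists>l h. bij_betw (c \<circ> prod.swap) {e \<in> F. fst e = a} {l..h}" by blast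
  next
    fix b assume "b \<in> snd ` F"
    then obtain l h where "bij_betw c {e \<in> F\<inverse>. fst e = b} {l..h}" using c(1) img(1) by metis
    from bij_betw_trans[OF bij_betw_swap(2) this]
    show "\<exists>l h. bij_betw (c \<circ> prod.swap) {e \<in> F. snd e = b} {l..h}" by blast
  qed
qed

text \<open>The fibres of \<open>p\<close> are disjoint, so their separate numberings combine into
  one function.\<close>

lemma exists_fibre_numbering:
  assumes "finite F"
  shows "\<exists>h :: 'a \<Rightarrow> nat. \<forall>b. bij_betw h {e \<in> F. p e = b} {..<card {e \<in> F. p e = b}}"
proof -
  have "\<forall>b. \<exists>h :: 'a \<Rightarrow> nat. bij_betw h {e \<in> F. p e = b} {..<card {e \<in> F. p e = b}}"
    using assms ex_bij_betw_finite_nat by (metis (no_types, lifting) finite_Collect_conjI lessThan_atLeast0 mem_Collect_eq finite_subset subsetI)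
  then obtain h where h: "\<And>b. bij_betw (h b :: 'a \<Rightarrow> nat) {e \<in> F. p e = b} {..<card {e \<in> F. p e = b}}"
    by metis
  have "bij_betw (\<lambda>e. h (p e) e) {e \<in> F. p e = b} {..<card {e \<in> F. p e = b}}" for b
    using h[of b] by (rule iffD2[OF bij_betw_cong, rotated]) simp
  then show ?thesis by blast
qed

text \<open>Such an \<open>F\<close> is a star forest with centres in the second part. The edges at
  each centre are numbered from 0; a leaf sees one colour, which is always an interval.\<close>

lemma pair_colourable_if_inj_on_fst:
  assumes "inj_on fst F" "finite F"
  shows "pair_colourable F"
proof -
  obtain h where h: "\<And>b. bij_betw h {e \<in> F. snd e = b} {..<card {e \<in> F. snd e = b}}"
    using exists_fibre_numbering[OF assms(2), of snd] by blast
  show ?thesis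
    unfolding pair_colourable_def
  proof (intro exI[of _ "\<lambda>e. int (h e)"] conjI ballI)
    fix a assume "a \<in> fst ` F"
    then obtain e where "e \<in> F" "a = fst e" by blast
    then have "{e' \<in> F. fst e' = a} = {e}" using assms(1) by (auto simp: inj_on_def)
    then show "\<exists>l u. bij_betw (\<lambda>e. int (h e)) {e \<in> F. fst e = a} {l..u}"
      by (intro exI[of _ "int (h e)"]) (simp add: bij_betw_def)
  next
    fix b
    show "\<exists>l u. bij_betw (\<lambda>e. int (h e)) {e \<in> F. snd e = b} {l..u}"
      using bij_betw_int_lessThan[OF h] by blast
  qed
qed

lemma pair_colourable_if_inj_on_snd:
  assumes "inj_on snd F" "finite F"
  shows "pair_colourable F"
proof (rule pair_colourable_converse, rule pair_colourable_if_inj_on_fst)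
  show "inj_on fst (F\<inverse>)" using assms(1) by (auto simp: inj_on_def) (metis prod.inject snd_conv)
  show "finite (F\<inverse>)" using assms(2) by simp
qed

lemma decomposable_empty: "decomposable {} 0"
  by (simp add: decomposable_def pair_colourable_empty)

lemma decomposable_Suc_0:
  assumes "pair_colourable F"
  shows "decomposable F (Suc 0)"
proof -
  have "pair_colourable {e \<in> F. 0 = i}" for i :: nat
    using assms pair_colourable_empty by (cases "0 = i") auto
  then show ?thesis unfolding decomposable_def by (intro exI[of _ "\<lambda>_. 0"]) auto
qed

lemma decomposable_Un:
  assumes "decomposable E k" "decomposable E' k'" "E \<inter> E' = {}"
  shows "decomposable (E \<union> E') (k + k')"
proof -
  obtain g g' where g: "\<forall>e\<in>E. g e < k" "\<And>i. pair_colourable {e \<in> E. g e = i}"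
    and g': "\<forall>e\<in>E'. g' e < k'" "\<And>i. pair_colourable {e \<in> E'. g' e = i}"
    using assms unfolding decomposable_def by blast
  define h where "h e = (if e \<in> E then g e else k + g' e)" for e
  have "pair_colourable {e \<in> E \<union> E'. h e = i}" for i
  proof (cases "i < k")
    case True
    then have "{e \<in> E \<union> E'. h e = i} = {e \<in> E. g e = i}" by (auto simp: h_def)
    then show ?thesis using g(2) by simp
  next
    case False
    then have "{e \<in> E \<union> E'. h e = i} = {e \<in> E'. g' e = i - k}"
      using g(1) assms(3) by (auto simp: h_def)
    then show ?thesis using g'(2) by simp
  qed
  moreover have "\<forall>e\<in>E \<union> E'. h e < k + k'" using g(1) g'(1) by (auto simp: h_def trans_less_add1)
  ultimately show ?thesis unfolding decomposable_def by blast
qed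

text \<open>Each vertex of degree at least \<open>d\<close> in the first part gives a star of its
  own, and counting edges bounds the number \<open>k\<close> of these. At every other vertex of that
  part the edges are numbered below \<open>d\<close>; edges with equal numbers have distinct first
  ends and so form a star forest.\<close>

lemma decomposable_star_forests:
  fixes R :: "('a \<times> 'b) set"
  assumes fin: "finite R"
  shows "\<exists>k. decomposable R (k + d) \<and> k * d \<le> card R"
proof -
  define N where "N a = {e \<in> R. fst e = a}" for a
  define H where "H = {a \<in> fst ` R. d \<le> card (N a)}"
  have finH: "finite H" using fin by (simp add: H_def)
  obtain h where h: "bij_betw h H {0..<card H}" using ex_bij_betw_finite_nat[OF finH] by blast
  have "decomposable {e \<in> R. fst e \<in> H} (card H)"
    unfolding decomposable_def
  proof (intro exI[of _ "\<lambda>e. h (fst e)"] conjI allI ballI)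
    fix e assume "e \<in> {e \<in> R. fst e \<in> H}"
    then show "h (fst e) < card H" using h by (auto simp: bij_betw_def)
  next
    fix i
    show "pair_colourable {e \<in> {e \<in> R. fst e \<in> H}. h (fst e) = i}"
    proof (rule pair_colourable_if_inj_on_snd)
      show "inj_on snd {e \<in> {e \<in> R. fst e \<in> H}. h (fst e) = i}"
        using h by (auto simp: inj_on_def bij_betw_def)
    qed (use fin in auto)
  qed
  moreover have "decomposable {e \<in> R. fst e \<notin> H} d"
  proof -
    obtain g where g: "\<And>a. bij_betw g {e \<in> R. fst e = a} {..<card {e \<in> R. fst e = a}}"
      using exists_fibre_numbering[OF fin, of fst] by blast
    show ?thesis
      unfolding decomposable_def
    proof (intro exI[of _ g] conjI allI ballI)
      fix e assume e: "e \<in> {e \<in> R. fst e \<notin> H}"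
      then have "card (N (fst e)) < d" by (auto simp: H_def)
      moreover have "g e < card (N (fst e))" using g[of "fst e"] e by (auto simp: bij_betw_def N_def)
      ultimately show "g e < d" by simp
    next
      fix i
      show "pair_colourable {e \<in> {e \<in> R. fst e \<notin> H}. g e = i}"
      proof (rule pair_colourable_if_inj_on_fst)
        show "inj_on fst {e \<in> {e \<in> R. fst e \<notin> H}. g e = i}"
        proof (rule inj_onI)
          fix e e' assume "e \<in> {e \<in> {e \<in> R. fst e \<notin> H}. g e = i}"
            "e' \<in> {e \<in> {e \<in> R. fst e \<notin> H}. g e = i}" "fst e = fst e'"
          then show "e = e'" using g[of "fst e"] unfolding bij_betw_def by (auto dest: inj_onD)
        qed
      qed (use fin in auto)
    qed
  qed
  ultimately have "decomposable ({e \<in> R. fst e \<in> H} \<union> {e \<in> R. fst e \<notin> H}) (card H + d)"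
    by (rule decomposable_Un) auto
  also have "{e \<in> R. fst e \<in> H} \<union> {e \<in> R. fst e \<notin> H} = R" by auto
  finally have "decomposable R (card H + d)" .
  moreover have "card H * d \<le> card R"
  proof -
    have "card H * d \<le> (\<Sum>a\<in>H. card (N a))"
      using sum_bounded_below[of H d "\<lambda>a. card (N a)"] by (simp add: H_def)
    also have "\<dots> \<le> (\<Sum>a\<in>fst ` R. card (N a))"
      using fin by (intro sum_mono2) (auto simp: H_def)
    also have "\<dots> = card R"
      using sum.image_gen[OF fin, of "\<lambda>_. 1::nat" fst] by (simp add: N_def)
    finally show ?thesis .
  qed
  ultimately show ?thesis by blast
qed

section \<open>Iterated removal and the choice of parameters\<close>

text \<open>Each round costs one class and removes at least r P / (2 \<open>card A\<close>) edges.
  The bound on \<open>N\<close> sums this over all rounds, with denominators cleared.\<close>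

lemma decomposable_up_to_sparse:
  fixes P :: real
  assumes fin: "finite A" "finite B" "card A = card B" and "E \<subseteq> A \<times> B"
    and r: "r > 0" "P > 0" and P: "30 * real r * real (card A) ^ 5 \<le> P ^ 3"
  shows "\<exists>N R. R \<subseteq> E \<and> real (card R) < 2 * P \<and> decomposable (E - R) N \<and>
    real N * (real r * P) \<le> 2 * real (card A) * real (card E)"
  using \<open>E \<subseteq> A \<times> B\<close>
proof (induction "card E" arbitrary: E rule: less_induct)
  case less
  show ?case
  proof (cases "real (card E) < 2 * P")
    case True
    then show ?thesis using decomposable_empty by (intro exI[of _ 0] exI[of _ E]) auto
  next
    case False
    obtain F where F: "F \<subseteq> E" "one_factorable r F"
      "real r * (real (card E) - P) \<le> 2 * real (card A) * real (card F)"
      using exists_large_one_factorable_subset[OF fin less.prems r P] by blast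
    have finE: "finite E" using less.prems fin by (meson finite_SigmaI finite_subset)
    \<comment> \<open>Stopping at 2P rather than P guarantees \<open>card E - P \<ge> P\<close> in
      each round, which makes the progress uniform.\<close>
    have "real r * P \<le> real r * (real (card E) - P)"
      using False by (intro mult_left_mono) auto
    with F(3) have rP: "real r * P \<le> 2 * real (card A) * real (card F)" by linarith
    moreover have "real r * P > 0" using r by simp
    ultimately have "card F \<noteq> 0" by (intro notI) simp
    moreover have cE: "card E = card F + card (E - F)"
      using F(1) finE by (metis card_Diff_subset card_mono finite_subset le_add_diff_inverse)
    ultimately have "card (E - F) < card E" by simp
    then obtain N R where NR: "R \<subseteq> E - F" "real (card R) < 2 * P" "decomposable (E - F - R) N"
      "real N * (real r * P) \<le> 2 * real (card A) * real (card (E - F))"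
      using less.hyps[of "E - F"] less.prems by blast
    have "decomposable (F \<union> (E - F - R)) (Suc 0 + N)"
      using F(2) NR(3) by (intro decomposable_Un decomposable_Suc_0 one_factorable_imp_pair_colourable) auto
    moreover have "F \<union> (E - F - R) = E - R" using F(1) NR(1) by auto
    moreover have "real (Suc N) * (real r * P) \<le> 2 * real (card A) * real (card E)"
      using NR(4) rP by (simp add: cE algebra_simps)
    ultimately show ?thesis using NR(1,2) by (intro exI[of _ "Suc N"] exI[of _ R]) auto
  qed
qed

lemma decomposable_bound:
  fixes E :: "('a \<times> 'b) set"
  assumes fin: "finite A" "finite B" "card A = card B" and E: "E \<subseteq> A \<times> B" and "A \<noteq> {}"
  shows "\<exists>k. decomposable E k \<and> real k \<le> 11 * real (card A) powr (8/9)"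
proof -
  define m where "m = real (card A)"
  have "card A > 0" using assms(1,5) by (metis card_gt_0_iff)
  then have m1: "m \<ge> 1" by (simp add: m_def)
  \<comment> \<open>With P of order r^(1/3) m^(5/3) there are about (m/r)^(4/3) rounds, while the
    best \<open>d\<close>, about the square root of P, gives about r^(1/6) m^(5/6) stars and star
    forests. These balance at r = m^(1/3), both being m^(8/9). The factor 4 in \<open>P\<close>
    serves 30 \<le> 4^3. The final 11 is 1 + 8 + 2, from \<open>N\<close>, \<open>k\<close> and
    \<open>d\<close>.\<close>
  define r where "r = nat \<lfloor>m powr (1/3)\<rfloor>"
  define P where "P = 4 * m powr (16/9)"
  define d where "d = nat \<lceil>m powr (8/9)\<rceil>"
  have third: "m powr (1/3) \<ge> 1" and eight: "m powr (8/9) \<ge> 1" using m1 by (auto intro: ge_one_powr_ge_zero)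
  have "\<lfloor>m powr (1/3)\<rfloor> \<ge> 1" using third by simp
  then have "real r = of_int \<lfloor>m powr (1/3)\<rfloor>" "of_int \<lfloor>m powr (1/3)\<rfloor> \<ge> (1 :: real)"
    by (simp_all add: r_def)
  \<comment> \<open>Rounding a number that is at least 1 down loses at most half of it.\<close>
  then have r: "r > 0" "real r \<le> m powr (1/3)" "m powr (1/3) / 2 \<le> real r" by linarith+
  have d: "m powr (8/9) \<le> real d" "real d \<le> 2 * m powr (8/9)"
    using eight unfolding d_def by linarith+
  have P0: "P > 0" using m1 by (simp add: P_def)
  have "30 * real r * m ^ 5 \<le> 64 * (m powr (1/3) * m ^ 5)"
    using r(2) m1 by (simp add: mult.assoc)
  also have "m powr (1/3) * m ^ 5 = m powr (16/3)"
    using m1 by (simp flip: powr_numeral powr_add)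
  also have "64 * m powr (16/3) = P ^ 3"
    using m1 by (simp add: P_def power_mult_distrib powr_powr flip: powr_numeral)
  finally have P3: "30 * real r * real (card A) ^ 5 \<le> P ^ 3" by (simp add: m_def)
  obtain N R where NR: "R \<subseteq> E" "real (card R) < 2 * P" "decomposable (E - R) N"
    "real N * (real r * P) \<le> 2 * m * real (card E)"
    using decomposable_up_to_sparse[OF fin E r(1) P0 P3] unfolding m_def by blast
  have finE: "finite E" using E fin by (meson finite_SigmaI finite_subset)
  obtain k where k: "decomposable R (k + d)" "k * d \<le> card R"
    using decomposable_star_forests[of R d] NR(1) finE finite_subset by blast
  have "decomposable ((E - R) \<union> R) (N + (k + d))"
    using NR(3) k(1) by (rule decomposable_Un) auto
  then have "decomposable E (N + (k + d))" using NR(1) by (simp add: Un_absorb2)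
  moreover have "real N \<le> m powr (8/9)"
  proof -
    have "card E \<le> card A * card A" using card_mono[OF _ E] fin by (simp add: card_cartesian_product)
    then have cE: "real (card E) \<le> m * m" unfolding m_def by (simp flip: of_nat_mult)
    \<comment> \<open>The exponent 19/9 = 1/3 + 16/9 is that of \<open>r * P\<close>, and 3 - 19/9 =
      8/9.\<close>
    have eq: "2 * m powr (19/9) = m powr (1/3) / 2 * P"
      using m1 by (simp add: P_def flip: powr_add)
    have "real N * (2 * m powr (19/9)) \<le> real N * (real r * P)"
      unfolding eq using r(3) P0 by (intro mult_left_mono mult_right_mono) auto
    also have "\<dots> \<le> 2 * m * real (card E)" by fact
    also have "\<dots> \<le> 2 * m * (m * m)" using cE m1 by (intro mult_left_mono) auto
    also have "\<dots> = 2 * m ^ 3" by (simp add: power3_eq_cube)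
    also have "\<dots> = m powr (8/9) * (2 * m powr (19/9))"
      using m1 by (simp flip: powr_add powr_numeral)
    finally show ?thesis using m1 by simp
  qed
  moreover have "real k \<le> 8 * m powr (8/9)"
  proof -
    have "real k * m powr (8/9) \<le> real k * real d" using d by (intro mult_left_mono) auto
    also have "\<dots> \<le> real (card R)" using k(2) by (simp flip: of_nat_mult)
    also have "\<dots> \<le> 8 * m powr (16/9)" using NR(2) by (simp add: P_def)
    also have "\<dots> = 8 * m powr (8/9) * m powr (8/9)" by (simp flip: powr_add)
    finally show ?thesis using m1 by simp
  qed
  ultimately show ?thesis using d(2) unfolding m_def by (intro exI[of _ "N + (k + d)"]) auto
qed

section \<open>Transfer to graphs and the final bound\<close>

lemma inj_on_doubleton:
  assumes "A \<inter> B = {}"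
  shows "inj_on (\<lambda>(a, b). {a, b}) (A \<times> B)"
  using assms by (auto simp: inj_on_def doubleton_eq_iff)

text \<open>As the parts are disjoint, an edge determines its ordered pair, so the colouring can be
  carried over. Each vertex lies in one part only, and the edges at it are the image of a single
  fibre of \<open>fst\<close> or \<open>snd\<close>.\<close>

lemma interval_colourable_if_pair_colourable:
  fixes Q :: "('a \<times> 'a) set"
  assumes disj: "A \<inter> B = {}" and Q: "Q \<subseteq> A \<times> B" and "pair_colourable Q"
  defines "h \<equiv> (\<lambda>(a, b). {a, b})"
  shows "interval_colourable (\<Union>(h ` Q)) (h ` Q)"
proof -
  obtain c :: "_ \<Rightarrow> int" where
    c: "\<forall>a\<in>fst ` Q. \<exists>l h. bij_betw c {e \<in> Q. fst e = a} {l..h}"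
      "\<forall>b\<in>snd ` Q. \<exists>l h. bij_betw c {e \<in> Q. snd e = b} {l..h}"
    using \<open>pair_colourable Q\<close> unfolding pair_colourable_def by blast
  have inj: "inj_on h (A \<times> B)" unfolding h_def by (rule inj_on_doubleton[OF disj])
  define c' where "c' = c \<circ> inv_into (A \<times> B) h"
  have img: "\<exists>l u. image_mset c' (mset_set (h ` Z)) = mset_set {l..u}"
    if Z: "Z \<subseteq> Q" "\<exists>l u. bij_betw c Z {l..u}" for Z
  proof -
    have ZAB: "Z \<subseteq> A \<times> B" using Z Q by blast
    have injZ: "inj_on c Z" using Z(2) by (auto simp: bij_betw_def)
    have c'h: "c' (h z) = c z" if "z \<in> Z" for z
      using that ZAB inj by (auto simp: c'_def)
    then have inj': "inj_on c' (h ` Z)" using injZ by (auto simp: inj_on_def)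
    have "image_mset c' (mset_set (h ` Z)) = mset_set (c' ` h ` Z)"
      by (rule image_mset_mset_set[OF inj'])
    also have "c' ` h ` Z = c ` Z" using c'h by (force simp: image_image)
    finally show ?thesis using Z(2) by (metis bij_betw_def)
  qed
  show ?thesis
    unfolding interval_colourable_def interval_colouring_def
  proof (intro exI[of _ c'] ballI)
    fix x assume "x \<in> \<Union>(h ` Q)"
    then consider "x \<in> A" "x \<in> fst ` Q" | "x \<in> B" "x \<in> snd ` Q" using Q by (force simp: h_def)
    then show "\<exists>a b. image_mset c' (mset_set {e \<in> h ` Q. x \<in> e}) = mset_set {a..b}"
    proof cases
      case 1
      then have "{e \<in> h ` Q. x \<in> e} = h ` {e \<in> Q. fst e = x}"
        using Q disj by (auto simp: h_def)
      then show ?thesis using img[of "{e \<in> Q. fst e = x}"] c(1) 1 by auto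
    next
      case 2
      then have "{e \<in> h ` Q. x \<in> e} = h ` {e \<in> Q. snd e = x}"
        using Q disj by (auto simp: h_def)
      then show ?thesis using img[of "{e \<in> Q. snd e = x}"] c(2) 2 by auto
    qed
  qed
qed

lemma interval_thickness_le_if_decomposable:
  fixes R :: "('a \<times> 'a) set"
  assumes disj: "A \<inter> B = {}" and R: "R \<subseteq> A \<times> B" and "decomposable R k"
  shows "interval_thickness ((\<lambda>(a, b). {a, b}) ` R) \<le> k"
proof -
  define h :: "'a \<times> 'a \<Rightarrow> 'a set" where "h = (\<lambda>(a, b). {a, b})"
  obtain g where g: "\<forall>e\<in>R. g e < k" "\<And>i. pair_colourable {e \<in> R. g e = i}"
    using \<open>decomposable R k\<close> unfolding decomposable_def by blast
  have inj: "inj_on h R"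
    using inj_on_subset[OF inj_on_doubleton[OF disj] R] by (simp add: h_def)
  define p where "p i = h ` {e \<in> R. g e = i}" for i
  \<comment> \<open>Empty classes are dropped since a partition has no empty parts; this only lowers
    the count.\<close>
  define P where "P = p ` {..<k} - {{}}"
  have "partition_on (h ` R) P"
    unfolding partition_on_def
  proof (intro conjI)
    show "\<Union>P = h ` R" using g(1) by (auto simp: P_def p_def)
    show "disjoint P"
    proof (rule disjointI)
      fix X Y assume "X \<in> P" "Y \<in> P" "X \<noteq> Y"
      then obtain i j where ij: "X = p i" "Y = p j" "i \<noteq> j" by (auto simp: P_def)
      have "X \<inter> Y = h ` ({e \<in> R. g e = i} \<inter> {e \<in> R. g e = j})"
        unfolding ij p_def by (rule inj_on_image_Int[OF inj, symmetric]) auto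
      then show "X \<inter> Y = {}" using ij(3) by auto
    qed
    show "{} \<notin> P" by (simp add: P_def)
  qed
  moreover have "finite P" by (simp add: P_def)
  moreover have "interval_colourable (\<Union>F) F" if "F \<in> P" for F
  proof -
    obtain i where "F = p i" using \<open>F \<in> P\<close> by (auto simp: P_def)
    moreover have "{e \<in> R. g e = i} \<subseteq> A \<times> B" using R by blast
    ultimately show ?thesis
      using interval_colourable_if_pair_colourable[OF disj _ g(2)[of i]] by (simp add: p_def h_def)
  qed
  ultimately have "interval_thickness (h ` R) \<le> card P"
    unfolding interval_thickness_def by (intro Least_le) blast
  also have "\<dots> \<le> card (p ` {..<k})" unfolding P_def by (intro card_mono) auto
  also have "\<dots> \<le> k" using card_image_le[of "{..<k}" p] by simp
  finally show ?thesis by (simp add: h_def)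
qed

theorem theorem3p1:
  "\<exists>f :: nat \<Rightarrow> real. f \<longlonglongrightarrow> 0 \<and>
     (\<forall>(V :: 'a set) E A B.
        simple_graph V E \<longrightarrow> bipartition V E A B \<longrightarrow> card A = card B \<longrightarrow>
        real (interval_thickness E) \<le> real (card V) powr (8 / 9 + f (card V)))"
proof (intro exI[of _ "\<lambda>n. ln 11 / ln (real n)"] conjI allI impI)
  \<comment> \<open>The witness absorbs the constant factor: n^(ln 11 / ln n) = 11 for n >
    1.\<close>
  show "(\<lambda>n. ln 11 / ln (real n)) \<longlonglongrightarrow> 0"
    by (intro tendsto_divide_0[OF tendsto_const] filterlim_at_top_imp_at_infinity
        filterlim_compose[OF ln_at_top] filterlim_real_sequentially)
next
  fix V :: "'a set" and E A B
  assume "simple_graph V E" and bip: "bipartition V E A B" and card: "card A = card B"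
  then have V: "A \<union> B = V" "A \<inter> B = {}" "finite A" "finite B"
    by (auto simp: simple_graph_def bipartition_def)
  define R where "R = {(a, b). a \<in> A \<and> b \<in> B \<and> {a, b} \<in> E}"
  have R: "R \<subseteq> A \<times> B" "E = (\<lambda>(a, b). {a, b}) ` R"
    using bip by (force simp: R_def bipartition_def)+
  show "real (interval_thickness E) \<le> real (card V) powr (8/9 + ln 11 / ln (real (card V)))"
  \<comment> \<open>Without vertices the thickness is 0. Otherwise n is at least 2, so
    \<open>ln n\<close> is nonzero.\<close>
  proof (cases "A = {}")
    case True
    then have "R = {}" using R by blast
    then have "interval_thickness E \<le> 0"
      unfolding R(2) using interval_thickness_le_if_decomposable[OF V(2), of "{}" 0] decomposable_empty by simp
    then show ?thesis by simp
  next
    case False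
    define n where "n = real (card V)"
    have cV: "card V = card A + card B" using V by (auto simp: card_Un_disjoint)
    have "card A > 0" using False V by (simp add: card_gt_0_iff)
    then have n: "n > 1" "real (card A) \<le> n" using cV card by (auto simp: n_def)
    obtain k where k: "decomposable R k" "real k \<le> 11 * real (card A) powr (8/9)"
      using decomposable_bound[OF V(3,4) card R(1) False] by blast
    have "real (interval_thickness E) \<le> real k"
      unfolding R(2) using interval_thickness_le_if_decomposable[OF V(2) R(1) k(1)] by simp
    also have "\<dots> \<le> 11 * real (card A) powr (8/9)" by fact
    also have "\<dots> \<le> 11 * n powr (8/9)" using n by (intro mult_left_mono powr_mono2) auto
    also have "\<dots> = n powr (8/9 + ln 11 / ln n)"
    proof -
      have "(8/9 + ln 11 / ln n) * ln n = 8/9 * ln n + ln 11" using n by (simp add: field_simps)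
      then show ?thesis using n by (simp add: powr_def exp_add)
    qed
    finally show ?thesis by (simp add: n_def)
  qed
qed

end
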